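(* Let $n\ge 1$, let $\mathbf{A}\in\mathbb{C}^{n\times n}$ be any Hermitian matrix, and let $\lambda$ be the maximum eigenvalue of $\mathbf{A}$. Let $\mathbf{x}_s\in\mathbb{C}^n$ be a fixed vector. Then for every $\mathbf{x}\in\mathbb{C}^n$, $$\mathbf{x}^H \mathbf{A}\,\mathbf{x} \;\le\; \lambda\, \mathbf{x}^H \mathbf{x} + \mathbf{x}_s^H(\lambda \mathbf{I}-\mathbf{A})\mathbf{x}_s + 2\,\mathrm{Re}\left\{\mathbf{x}^H(\mathbf{A}-\lambda\mathbf{I})\mathbf{x}_s\right\}.$$
   Context: $(\cdot)^H$ denotes conjugate transpose, $\mathbf{I}$ the $n\times n$ identity matrix, and $\mathrm{Re}$ the real part. For Hermitian matrices the quadratic forms $\mathbf{x}^H\mathbf{A}\mathbf{x}$ and $\mathbf{x}_s^H(\lambda\mathbf{I}-\mathbf{A})\mathbf{x}_s$ are real, so the inequality is between real numbers. *)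

theory Defs
  imports
    "Jordan_Normal_Form.Schur_Decomposition"
    "Jordan_Normal_Form.Spectral_Radius"
    "HOL-Library.Complex_Order"
begin

definition hermitian_mat :: "complex mat \<Rightarrow> bool" where
  "hermitian_mat A \<longleftrightarrow> square_mat A \<and> mat_adjoint A = A"

text \<open>
  The eigenvalues of a Hermitian matrix are real, so the maximum ranges over its whole spectrum.
  For a Hermitian matrix of positive dimension the set is finite and nonempty, which
  \<^const>\<open>Max\<close> requires.
\<close>
definition max_eigenvalue :: "complex mat \<Rightarrow> real" where
  "max_eigenvalue A = Max {r. eigenvalue A (complex_of_real r)}"

text \<open>
  The form \<open>x\<^sup>H M y\<close>. The product \<open>\<bullet>\<close> is bilinear, so the conjugation is explicit.
  Inequalities between such forms use the order of \<^theory>\<open>HOL-Library.Complex_Order\<close>: \<open>a \<le> b\<close>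
  means \<open>Re a \<le> Re b\<close> and \<open>Im a = Im b\<close>, which extends the order of the reals.
\<close>
definition sesq_form :: "complex vec \<Rightarrow> complex mat \<Rightarrow> complex vec \<Rightarrow> complex" where
  "sesq_form x M y = conjugate x \<bullet> (M *\<^sub>v y)"

end

theory Submission
  imports Defs
begin

text \<open>
  With \<open>M = \<lambda>I - A\<close> the claim is \<open>(x - x\<^sub>s)\<^sup>H M (x - x\<^sub>s) \<ge> 0\<close>, so it suffices that \<open>M\<close> is positive
  semidefinite. Let \<open>\<mu>\<close> be the infimum of all \<open>c\<close> with \<open>z\<^sup>H A z \<le> c z\<^sup>H z\<close> for all \<open>z\<close>. Then
  \<open>\<mu>I - A\<close> is positive semidefinite. If it were invertible, its form would be bounded below by
  \<open>\<delta> z\<^sup>H z\<close> for some \<open>\<delta> > 0\<close>, and \<open>\<mu> - \<delta>\<close> would contradict the choice of \<open>\<mu>\<close>. So \<open>\<mu>\<close> is an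
  eigenvalue and \<open>\<mu> \<le> \<lambda>\<close>.
\<close>

section \<open>Euclidean norm and crude bounds for matrices and forms\<close>

definition vec_norm_sq :: "complex vec \<Rightarrow> real" where
  "vec_norm_sq v = (\<Sum>i<dim_vec v. (cmod (v $ i))\<^sup>2)"

lemma conjugate_scalar_prod_self: "conjugate v \<bullet> v = complex_of_real (vec_norm_sq v)"
  unfolding scalar_prod_def vec_norm_sq_def
  by (auto simp: complex_norm_square mult.commute atLeast0LessThan simp del: of_real_power
      intro!: sum.cong)

lemma vec_norm_sq_nonneg: "0 \<le> vec_norm_sq v"
  unfolding vec_norm_sq_def by (simp add: sum_nonneg)

lemma cmod_index_le_vec_norm_sq:
  assumes "i < dim_vec v"
  shows "cmod (v $ i) \<le> sqrt (vec_norm_sq v)"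
proof (rule real_le_rsqrt)
  show "(cmod (v $ i))\<^sup>2 \<le> vec_norm_sq v"
    unfolding vec_norm_sq_def using assms by (intro member_le_sum) auto
qed

lemma vec_norm_sq_unit_vec:
  assumes "i < n"
  shows "vec_norm_sq (unit_vec n i) = 1"
proof -
  have "complex_of_real (vec_norm_sq (unit_vec n i)) = 1"
    unfolding conjugate_scalar_prod_self[symmetric] using assms by simp
  then show ?thesis by simp
qed

lemma cmod_mult_mat_vec_le:
  assumes "M \<in> carrier_mat m n" "z \<in> carrier_vec n" "i < m"
  shows "cmod ((M *\<^sub>v z) $ i) \<le> (\<Sum>j<n. cmod (M $$ (i, j))) * sqrt (vec_norm_sq z)"
proof -
  have "(M *\<^sub>v z) $ i = (\<Sum>j<n. M $$ (i, j) * z $ j)"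
    using assms by (auto simp: scalar_prod_def atLeast0LessThan intro!: sum.cong)
  also have "cmod \<dots> \<le> (\<Sum>j<n. cmod (M $$ (i, j) * z $ j))"
    by (rule norm_sum)
  also have "\<dots> \<le> (\<Sum>j<n. cmod (M $$ (i, j)) * sqrt (vec_norm_sq z))"
    using assms by (intro sum_mono) (auto simp: norm_mult intro!: mult_left_mono cmod_index_le_vec_norm_sq)
  finally show ?thesis by (simp add: sum_distrib_right)
qed

text \<open>Each coordinate is bounded by its absolute row sum times the norm of \<open>z\<close>.
  Any finite constant will do: applied to an inverse, it bounds \<open>z\<close> by its
  image.\<close>

lemma vec_norm_sq_mult_mat_bounded:
  assumes M: "M \<in> carrier_mat m n"
  obtains C where "C > 0" "\<And>z. z \<in> carrier_vec n \<Longrightarrow> vec_norm_sq (M *\<^sub>v z) \<le> C * vec_norm_sq z"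
proof
  let ?R = "\<lambda>i. \<Sum>j<n. cmod (M $$ (i, j))"
  \<comment> \<open>The summand 1 keeps the constant positive even when \<open>M\<close> is zero,
    since it is divided by later.\<close>
  let ?C = "(\<Sum>i<m. (?R i)\<^sup>2) + 1"
  show "?C > 0"
    by (simp add: sum_nonneg add_nonneg_pos)
  fix z :: "complex vec" assume z: "z \<in> carrier_vec n"
  have "vec_norm_sq (M *\<^sub>v z) \<le> (\<Sum>i<m. (?R i * sqrt (vec_norm_sq z))\<^sup>2)"
    unfolding vec_norm_sq_def[of "M *\<^sub>v z"] using M z
    by (auto intro!: sum_mono power_mono cmod_mult_mat_vec_le simp del: index_mult_mat_vec)
  also have "\<dots> = (\<Sum>i<m. (?R i)\<^sup>2) * vec_norm_sq z"
    unfolding sum_distrib_right[of _ "{..<m}"]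
    by (simp add: power_mult_distrib vec_norm_sq_nonneg)
  also have "\<dots> \<le> ?C * vec_norm_sq z"
    by (simp add: vec_norm_sq_nonneg distrib_right)
  finally show "vec_norm_sq (M *\<^sub>v z) \<le> ?C * vec_norm_sq z" .
qed

lemma sesq_form_bounded:
  assumes M: "M \<in> carrier_mat n n"
  obtains C where "C > 0" "\<And>z. z \<in> carrier_vec n \<Longrightarrow> cmod (sesq_form z M z) \<le> C * vec_norm_sq z"
proof
  let ?R = "\<lambda>i. \<Sum>j<n. cmod (M $$ (i, j))"
  let ?C = "(\<Sum>i<n. ?R i) + 1"
  show "?C > 0"
    by (simp add: sum_nonneg add_nonneg_pos)
  fix z :: "complex vec" assume z: "z \<in> carrier_vec n"
  let ?s = "sqrt (vec_norm_sq z)"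
  have "sesq_form z M z = (\<Sum>i<n. cnj (z $ i) * (M *\<^sub>v z) $ i)"
    unfolding sesq_form_def scalar_prod_def using M z
    by (auto simp: atLeast0LessThan intro!: sum.cong)
  also have "cmod \<dots> \<le> (\<Sum>i<n. cmod (cnj (z $ i) * (M *\<^sub>v z) $ i))"
    by (rule norm_sum)
  also have "\<dots> \<le> (\<Sum>i<n. ?s * (?R i * ?s))"
  proof (rule sum_mono)
    fix i assume "i \<in> {..<n}"
    then have "cmod (z $ i) \<le> ?s" "cmod ((M *\<^sub>v z) $ i) \<le> ?R i * ?s"
      using M z by (auto intro!: cmod_index_le_vec_norm_sq cmod_mult_mat_vec_le simp del: index_mult_mat_vec)
    then show "cmod (cnj (z $ i) * (M *\<^sub>v z) $ i) \<le> ?s * (?R i * ?s)"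
      unfolding norm_mult complex_mod_cnj by (intro mult_mono) (auto simp: vec_norm_sq_nonneg)
  qed
  also have "\<dots> = (\<Sum>i<n. ?R i * (?s * ?s))"
    by (intro sum.cong) simp_all
  also have "\<dots> = (\<Sum>i<n. ?R i) * vec_norm_sq z"
    unfolding sum_distrib_right[symmetric] by (simp add: vec_norm_sq_nonneg)
  also have "\<dots> \<le> ?C * vec_norm_sq z"
    by (simp add: vec_norm_sq_nonneg distrib_right)
  finally show "cmod (sesq_form z M z) \<le> ?C * vec_norm_sq z" .
qed

section \<open>Hermitian matrices and their sesquilinear forms\<close>

lemma hermitian_mat_index:
  assumes "hermitian_mat M" "M \<in> carrier_mat n n" "i < n" "j < n"
  shows "M $$ (i, j) = cnj (M $$ (j, i))"
proof -
  have "M $$ (i, j) = mat_adjoint M $$ (i, j)"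
    using assms by (simp add: hermitian_mat_def)
  also have "\<dots> = cnj (M $$ (j, i))"
    using assms(2-) by (simp add: mat_adjoint_def mat_of_rows_def)
  finally show ?thesis .
qed

text \<open>Conjugating the double sum conjugates the entries of \<open>M\<close>; interchanging the
  sums and using the symmetry of the entries restores the form with its arguments exchanged.\<close>

lemma sesq_form_hermitian:
  assumes "hermitian_mat M" "M \<in> carrier_mat n n" "x \<in> carrier_vec n" "y \<in> carrier_vec n"
  shows "sesq_form y M x = cnj (sesq_form x M y)"
proof -
  have expand: "sesq_form u M v = (\<Sum>i<n. \<Sum>j<n. cnj (u $ i) * M $$ (i, j) * v $ j)"
    if "u \<in> carrier_vec n" "v \<in> carrier_vec n" for u v
    unfolding sesq_form_def scalar_prod_def using that assms(2)
    by (auto simp: scalar_prod_def atLeast0LessThan sum_distrib_left mult.assoc intro!: sum.cong)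
  have "cnj (sesq_form x M y) = (\<Sum>i<n. \<Sum>j<n. x $ i * cnj (M $$ (i, j)) * cnj (y $ j))"
    by (simp add: expand assms)
  also have "\<dots> = (\<Sum>j<n. \<Sum>i<n. x $ i * cnj (M $$ (i, j)) * cnj (y $ j))"
    by (rule sum.swap)
  also have "\<dots> = (\<Sum>j<n. \<Sum>i<n. cnj (y $ j) * M $$ (j, i) * x $ i)"
  proof (intro sum.cong refl)
    fix j i assume "j \<in> {..<n}" "i \<in> {..<n}"
    then show "x $ i * cnj (M $$ (i, j)) * cnj (y $ j) = cnj (y $ j) * M $$ (j, i) * x $ i"
      using hermitian_mat_index[OF assms(1,2), of j i] by simp
  qed
  finally show ?thesis by (simp add: expand assms)
qed

lemma hermitian_matI:
  assumes M: "M \<in> carrier_mat n n" and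
    ij: "\<And>i j. i < n \<Longrightarrow> j < n \<Longrightarrow> M $$ (i, j) = cnj (M $$ (j, i))"
  shows "hermitian_mat M"
  unfolding hermitian_mat_def
proof
  show "square_mat M" using M by auto
  show "mat_adjoint M = M"
  proof (rule eq_matI)
    fix i j assume "i < dim_row M" "j < dim_col M"
    then show "mat_adjoint M $$ (i, j) = M $$ (i, j)"
      using M ij[of i j] by (simp add: mat_adjoint_def mat_of_rows_def)
  qed (use M in \<open>simp_all add: mat_adjoint_def\<close>)
qed

lemma hermitian_mat_shift:
  assumes "hermitian_mat A" "A \<in> carrier_mat n n"
  shows "hermitian_mat (complex_of_real c \<cdot>\<^sub>m 1\<^sub>m n - A)"
proof (rule hermitian_matI[of _ n])
  show "complex_of_real c \<cdot>\<^sub>m 1\<^sub>m n - A \<in> carrier_mat n n" using assms by auto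
  fix i j assume ij: "i < n" "j < n"
  show "(complex_of_real c \<cdot>\<^sub>m 1\<^sub>m n - A) $$ (i, j) = cnj ((complex_of_real c \<cdot>\<^sub>m 1\<^sub>m n - A) $$ (j, i))"
    using ij assms(2) by (simp add: hermitian_mat_index[OF assms ij])
qed

lemma sesq_form_shift:
  assumes "A \<in> carrier_mat n n" "x \<in> carrier_vec n" "y \<in> carrier_vec n"
  shows "sesq_form x (c \<cdot>\<^sub>m 1\<^sub>m n - A) y = c * (conjugate x \<bullet> y) - sesq_form x A y"
    and "sesq_form x (A - c \<cdot>\<^sub>m 1\<^sub>m n) y = sesq_form x A y - c * (conjugate x \<bullet> y)"
proof -
  have I: "(c \<cdot>\<^sub>m 1\<^sub>m n) *\<^sub>v y = c \<cdot>\<^sub>v y"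
    using assms by (intro eq_vecI) auto
  note d = minus_mult_distrib_mat_vec[of _ n n] scalar_prod_minus_distrib[of _ n]
  show "sesq_form x (c \<cdot>\<^sub>m 1\<^sub>m n - A) y = c * (conjugate x \<bullet> y) - sesq_form x A y"
    and "sesq_form x (A - c \<cdot>\<^sub>m 1\<^sub>m n) y = sesq_form x A y - c * (conjugate x \<bullet> y)"
    unfolding sesq_form_def using assms by (auto simp: d I)
qed

text \<open>The two cross terms are conjugate to each other, so their real parts agree and add
  up.\<close>

lemma Re_sesq_form_diff:
  assumes "hermitian_mat M" "M \<in> carrier_mat n n" "x \<in> carrier_vec n" "y \<in> carrier_vec n"
  shows "Re (sesq_form (x - complex_of_real t \<cdot>\<^sub>v y) M (x - complex_of_real t \<cdot>\<^sub>v y))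
    = Re (sesq_form x M x) - 2 * t * Re (sesq_form x M y) + t\<^sup>2 * Re (sesq_form y M y)"
proof -
  have conj: "conjugate (x - complex_of_real t \<cdot>\<^sub>v y) = conjugate x - complex_of_real t \<cdot>\<^sub>v conjugate y"
    using assms by (intro eq_vecI) auto
  have mult: "M *\<^sub>v (x - complex_of_real t \<cdot>\<^sub>v y) = M *\<^sub>v x - complex_of_real t \<cdot>\<^sub>v (M *\<^sub>v y)"
    using assms by (simp add: mult_minus_distrib_mat_vec[of _ n n] mult_mat_vec[of _ n n])
  have "sesq_form (x - complex_of_real t \<cdot>\<^sub>v y) M (x - complex_of_real t \<cdot>\<^sub>v y)
    = sesq_form x M x - t * sesq_form x M y - t * sesq_form y M x + t\<^sup>2 * sesq_form y M y"
    unfolding sesq_form_def conj mult using assms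
    by (simp add: minus_scalar_prod_distrib[of _ n] scalar_prod_minus_distrib[of _ n]
        power2_eq_square algebra_simps)
  then show ?thesis
    using sesq_form_hermitian[OF assms] by (simp flip: of_real_power)
qed

section \<open>Positive semidefinite forms and the largest eigenvalue\<close>

text \<open>Nonnegativity of the form at \<open>z - t M z\<close>, a quadratic in \<open>t\<close>,
  forces the form at \<open>z\<close> to be at least \<open>|M z|\<^sup>2 / C\<close>. Invertibility
  bounds \<open>|z|\<^sup>2\<close> by \<open>K |M z|\<^sup>2\<close>.\<close>

lemma psd_invertible_bounded_below:
  assumes herm: "hermitian_mat M" and M: "M \<in> carrier_mat n n"
    and psd: "\<And>z. z \<in> carrier_vec n \<Longrightarrow> 0 \<le> Re (sesq_form z M z)"
    and det: "det M \<noteq> 0"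
  obtains \<delta> where "\<delta> > 0" "\<And>z. z \<in> carrier_vec n \<Longrightarrow> \<delta> * vec_norm_sq z \<le> Re (sesq_form z M z)"
proof -
  \<comment> \<open>The argument \<open>()\<close> only fills the record extension of
    \<open>ring_mat\<close>.\<close>
  from det_non_zero_imp_unit[OF M det, of "()"]
  obtain W where W: "W \<in> carrier_mat n n" and WM: "W * M = 1\<^sub>m n"
    by (auto simp: Units_def ring_mat_def)
  obtain K where K: "K > 0" "\<And>z. z \<in> carrier_vec n \<Longrightarrow> vec_norm_sq (W *\<^sub>v z) \<le> K * vec_norm_sq z"
    using vec_norm_sq_mult_mat_bounded[OF W] by blast
  obtain C where C: "C > 0" "\<And>z. z \<in> carrier_vec n \<Longrightarrow> cmod (sesq_form z M z) \<le> C * vec_norm_sq z"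
    using sesq_form_bounded[OF M] by blast
  show thesis
  proof
    show "1 / (K * C) > 0" using K C by simp
    fix z :: "complex vec" assume z: "z \<in> carrier_vec n"
    define w where "w = M *\<^sub>v z"
    have w: "w \<in> carrier_vec n" using M z by (simp add: w_def)
    have "z = W *\<^sub>v w"
      using W M z WM by (simp add: w_def flip: assoc_mult_mat_vec[of W n n M n z])
    then have zw: "vec_norm_sq z \<le> K * vec_norm_sq w"
      using K(2)[OF w] by simp
    \<comment> \<open>As \<open>w = M z\<close>, the linear coefficient of the quadratic in
      \<open>t\<close> is governed by \<open>|w|\<^sup>2\<close> itself.\<close>
    have wz: "Re (sesq_form z M w) = vec_norm_sq w"
      using sesq_form_hermitian[OF herm M w z]
      by (simp add: sesq_form_def[of w] conjugate_scalar_prod_self flip: w_def)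
    \<comment> \<open>The step \<open>1 / C\<close> minimises \<open>- 2 t |w|\<^sup>2 + C t\<^sup>2 |w|\<^sup>2\<close>, which bounds the increment of the form from \<open>z\<close> to \<open>z - t w\<close>.\<close>
    have "0 \<le> Re (sesq_form z M z) - 2 * (1 / C) * vec_norm_sq w + (1 / C)\<^sup>2 * Re (sesq_form w M w)"
      using psd[of "z - complex_of_real (1 / C) \<cdot>\<^sub>v w"] z w Re_sesq_form_diff[OF herm M z w, of "1 / C"] wz
      by simp
    moreover have "(1 / C)\<^sup>2 * Re (sesq_form w M w) \<le> (1 / C)\<^sup>2 * (C * vec_norm_sq w)"
      using C(2)[OF w] complex_Re_le_cmod[of "sesq_form w M w"] by (intro mult_left_mono) auto
    moreover have "(1 / C)\<^sup>2 * (C * vec_norm_sq w) = (1 / C) * vec_norm_sq w"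
      using C(1) by (simp add: power2_eq_square)
    ultimately have "(1 / C) * vec_norm_sq w \<le> Re (sesq_form z M z)"
      by simp
    moreover have "1 / (K * C) * vec_norm_sq z \<le> (1 / C) * vec_norm_sq w"
      using zw K(1) C(1) by (simp add: field_simps)
    ultimately show "1 / (K * C) * vec_norm_sq z \<le> Re (sesq_form z M z)"
      by simp
  qed
qed

lemma Re_sesq_form_shift_self:
  assumes "A \<in> carrier_mat n n" "z \<in> carrier_vec n"
  shows "Re (sesq_form z (complex_of_real c \<cdot>\<^sub>m 1\<^sub>m n - A) z)
    = c * vec_norm_sq z - Re (sesq_form z A z)"
  using assms by (simp add: sesq_form_shift conjugate_scalar_prod_self)

lemma eigenvalue_if_det_shift_eq_0:
  assumes A: "A \<in> carrier_mat n n" and det: "det (c \<cdot>\<^sub>m 1\<^sub>m n - A) = (0 :: 'a :: field)"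
  shows "eigenvalue A c"
proof -
  have "c \<cdot>\<^sub>m 1\<^sub>m n - A \<in> carrier_mat n n" using A by auto
  from det_0_iff_vec_prod_zero_field[OF this] det
  obtain v where v: "v \<in> carrier_vec n" "v \<noteq> 0\<^sub>v n" "(c \<cdot>\<^sub>m 1\<^sub>m n - A) *\<^sub>v v = 0\<^sub>v n" by auto
  have I: "(c \<cdot>\<^sub>m 1\<^sub>m n) *\<^sub>v v = c \<cdot>\<^sub>v v"
    using v by (intro eq_vecI) auto
  have "c \<cdot>\<^sub>v v - A *\<^sub>v v = 0\<^sub>v n"
    using v A by (simp add: minus_mult_distrib_mat_vec[of _ n n] I)
  then have "(c \<cdot>\<^sub>v v - A *\<^sub>v v) $ i = 0" if "i < n" for i
    using that by simp
  then have "A *\<^sub>v v = c \<cdot>\<^sub>v v"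
    using A v(1) by (intro eq_vecI) auto
  then show ?thesis
    using v A unfolding eigenvalue_def eigenvector_def by auto
qed

lemma hermitian_eigenvalue_dominates:
  assumes n: "n \<ge> 1" and A: "A \<in> carrier_mat n n" and herm: "hermitian_mat A"
  obtains \<mu> where "eigenvalue A (complex_of_real \<mu>)"
    "\<And>z. z \<in> carrier_vec n \<Longrightarrow> Re (sesq_form z A z) \<le> \<mu> * vec_norm_sq z"
proof
  \<comment> \<open>The members of \<open>S\<close> are the upper bounds of the Rayleigh quotient,
    written without division so that \<open>z = 0\<close> is covered.\<close>
  define S where "S = {c. \<forall>z \<in> carrier_vec n. Re (sesq_form z A z) \<le> c * vec_norm_sq z}"
  define \<mu> where "\<mu> = Inf S"
  obtain C where "\<And>z. z \<in> carrier_vec n \<Longrightarrow> cmod (sesq_form z A z) \<le> C * vec_norm_sq z"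
    using sesq_form_bounded[OF A] by blast
  then have "C \<in> S"
    unfolding S_def using complex_Re_le_cmod order_trans by blast
  then have ne: "S \<noteq> {}" by blast
  \<comment> \<open>A single vector of norm 1 bounds \<open>S\<close> from below; it exists because
    \<open>n \<ge> 1\<close>.\<close>
  have lower: "Re (sesq_form (unit_vec n 0) A (unit_vec n 0)) \<le> c" if "c \<in> S" for c
  proof -
    have "Re (sesq_form (unit_vec n 0) A (unit_vec n 0)) \<le> c * vec_norm_sq (unit_vec n 0)"
      using that unfolding S_def by (blast intro: unit_vec_carrier)
    then show ?thesis using n vec_norm_sq_unit_vec[of 0 n] by simp
  qed
  then have bdd: "bdd_below S" by (rule bdd_belowI)
  show dom: "Re (sesq_form z A z) \<le> \<mu> * vec_norm_sq z" if z: "z \<in> carrier_vec n" for z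
  \<comment> \<open>If the norm vanishes, the factor in front of it is irrelevant, so the bound for
    \<open>C\<close> serves. Otherwise division makes the quotient a lower bound of
    \<open>S\<close>.\<close>
  proof (cases "vec_norm_sq z = 0")
    case True
    then show ?thesis using \<open>C \<in> S\<close> z unfolding S_def by force
  next
    case False
    then have pos: "vec_norm_sq z > 0" using vec_norm_sq_nonneg[of z] by simp
    have "Re (sesq_form z A z) / vec_norm_sq z \<le> \<mu>"
      unfolding \<mu>_def using ne
    proof (rule cInf_greatest)
      fix c assume "c \<in> S"
      then show "Re (sesq_form z A z) / vec_norm_sq z \<le> c"
        using z pos unfolding S_def by (auto simp: divide_le_eq)
    qed
    then show ?thesis using pos by (simp add: divide_le_eq)
  qed
  show "eigenvalue A (complex_of_real \<mu>)"
  proof (rule ccontr)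
    assume "\<not> eigenvalue A (complex_of_real \<mu>)"
    then have det: "det (complex_of_real \<mu> \<cdot>\<^sub>m 1\<^sub>m n - A) \<noteq> 0"
      using eigenvalue_if_det_shift_eq_0[OF A] by blast
    have M: "complex_of_real \<mu> \<cdot>\<^sub>m 1\<^sub>m n - A \<in> carrier_mat n n" using A by auto
    have psd: "0 \<le> Re (sesq_form z (complex_of_real \<mu> \<cdot>\<^sub>m 1\<^sub>m n - A) z)" if "z \<in> carrier_vec n" for z
      using dom[OF that] by (simp add: Re_sesq_form_shift_self[OF A that])
    obtain \<delta> where \<delta>: "\<delta> > 0" "\<And>z. z \<in> carrier_vec n \<Longrightarrow>
        \<delta> * vec_norm_sq z \<le> Re (sesq_form z (complex_of_real \<mu> \<cdot>\<^sub>m 1\<^sub>m n - A) z)"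
      using psd_invertible_bounded_below[OF hermitian_mat_shift[OF herm A] M psd det] by blast
    have "Re (sesq_form z A z) \<le> (\<mu> - \<delta>) * vec_norm_sq z" if "z \<in> carrier_vec n" for z
      using \<delta>(2)[OF that] by (simp add: Re_sesq_form_shift_self[OF A that] left_diff_distrib)
    then have "\<mu> - \<delta> \<in> S"
      unfolding S_def by blast
    then have "\<mu> \<le> \<mu> - \<delta>"
      unfolding \<mu>_def using bdd by (rule cInf_lower)
    with \<delta>(1) show False by simp
  qed
qed

text \<open>The dominating eigenvalue is one of the reals over which the maximum is taken, and this
  set is finite as the preimage of the spectrum under an injection.\<close>

lemma hermitian_form_le_max_eigenvalue:
  assumes n: "n \<ge> 1" and A: "A \<in> carrier_mat n n" and herm: "hermitian_mat A"
    and z: "z \<in> carrier_vec n"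
  shows "Re (sesq_form z A z) \<le> max_eigenvalue A * vec_norm_sq z"
proof -
  obtain \<mu> where \<mu>: "eigenvalue A (complex_of_real \<mu>)"
    and dom: "Re (sesq_form z A z) \<le> \<mu> * vec_norm_sq z"
    using hermitian_eigenvalue_dominates[OF n A herm] z by metis
  have "{r. eigenvalue A (complex_of_real r)} = complex_of_real -` spectrum A"
    by (auto simp: spectrum_def)
  then have "finite {r. eigenvalue A (complex_of_real r)}"
    using card_finite_spectrum(1)[OF A] by (simp add: finite_vimageI inj_of_real)
  then have "\<mu> \<le> max_eigenvalue A"
    unfolding max_eigenvalue_def using \<mu> by (intro Max_ge) auto
  then have "\<mu> * vec_norm_sq z \<le> max_eigenvalue A * vec_norm_sq z"
    by (intro mult_right_mono vec_norm_sq_nonneg)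
  with dom show ?thesis by simp
qed

text \<open>With equal arguments, the form equals its own conjugate.\<close>

lemma sesq_form_hermitian_self:
  assumes "hermitian_mat M" "M \<in> carrier_mat n n" "x \<in> carrier_vec n"
  shows "sesq_form x M x = complex_of_real (Re (sesq_form x M x))"
  using sesq_form_hermitian[OF assms assms(3)] by (simp add: complex_eq_iff)

theorem lemma1:
  fixes n :: nat and A :: "complex mat" and xs x :: "complex vec" and l :: real
  assumes "n \<ge> 1"
    and "A \<in> carrier_mat n n"
    and "hermitian_mat A"
    and "l = max_eigenvalue A"
    and "xs \<in> carrier_vec n"
    and "x \<in> carrier_vec n"
  shows "sesq_form x A x
    \<le> complex_of_real l * (conjugate x \<bullet> x)
      + sesq_form xs (complex_of_real l \<cdot>\<^sub>m 1\<^sub>m n - A) xs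
      + complex_of_real (2 * Re (sesq_form x (A - complex_of_real l \<cdot>\<^sub>m 1\<^sub>m n) xs))"
proof -
  let ?M = "complex_of_real l \<cdot>\<^sub>m 1\<^sub>m n - A"
  note A = assms(2) and herm = assms(3) and xs = assms(5) and x = assms(6)
  have M: "?M \<in> carrier_mat n n" using A by auto
  have hM: "hermitian_mat ?M" by (rule hermitian_mat_shift[OF herm A])
  \<comment> \<open>The scalar 1 is kept so that \<open>Re_sesq_form_diff\<close> applies with
    \<open>t = 1\<close>.\<close>
  let ?y = "x - complex_of_real 1 \<cdot>\<^sub>v xs"
  have y: "?y \<in> carrier_vec n" using x xs by simp
  have "0 \<le> Re (sesq_form ?y ?M ?y)"
    using hermitian_form_le_max_eigenvalue[OF assms(1) A herm y] Re_sesq_form_shift_self[OF A y, of l]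
      assms(4) by simp
  also have "\<dots> = Re (sesq_form x ?M x) - 2 * Re (sesq_form x ?M xs) + Re (sesq_form xs ?M xs)"
    using Re_sesq_form_diff[OF hM M x xs, of 1] by simp
  also have "Re (sesq_form x ?M x) = l * vec_norm_sq x - Re (sesq_form x A x)"
    by (rule Re_sesq_form_shift_self[OF A x])
  also have "Re (sesq_form x ?M xs) = - Re (sesq_form x (A - complex_of_real l \<cdot>\<^sub>m 1\<^sub>m n) xs)"
    by (simp add: sesq_form_shift[OF A x xs])
  finally have "Re (sesq_form x A x) \<le> l * vec_norm_sq x + Re (sesq_form xs ?M xs)
      + 2 * Re (sesq_form x (A - complex_of_real l \<cdot>\<^sub>m 1\<^sub>m n) xs)"
    by simp
  \<comment> \<open>The complex order also demands equal imaginary parts; the remaining terms are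
    visibly real.\<close>
  moreover have "Im (sesq_form x A x) = 0" "Im (sesq_form xs ?M xs) = 0"
    using sesq_form_hermitian_self[OF herm A x] sesq_form_hermitian_self[OF hM M xs]
    by (metis Im_complex_of_real)+
  ultimately show ?thesis
    by (simp add: less_eq_complex_def conjugate_scalar_prod_self)
qed

end
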